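(* For all integers $n,d\ge 0$, the correspondence $(G,\nu)\mapsto H^n_{(d)}(G,\nu)$ (acting on morphisms by pullback of cochains) is a contravariant functor from the category $\mathbf{NGrp}$ of normed groups to the category $\mathbf{Vect}_{\mathbb{R}}$ of real vector spaces.
   Context: A pseudo norm on a group $G$ is a function $\nu:G\to[0,\infty)$ with $\nu(gh)\le\nu(g)+\nu(h)$, $\nu(g^{-1})=\nu(g)$ and $\nu(1_G)=0$ for all $g,h\in G$. A normed group is a pair $(G,\nu)$ of a group and a pseudo norm on it. A homomorphism $\phi:G\to H$ between normed groups $(G,\nu_G)$, $(H,\nu_H)$ is Lipschitz if there are $C,D\ge0$ with $\nu_H(\phi(g))\le C\nu_G(g)+D$ for all $g\in G$. $\mathbf{NGrp}$ is the category whose objects are normed groups and whose morphisms are Lipschitz homomorphisms (with usual composition). Let $\bar C^n(G)$ be the space of functions $G^n\to\mathbb{R}$ with the coboundary $$\bar\delta\bar c(g_1,\dots,g_n)=\bar c(g_2,\dots,g_n)+\sum_{i=1}^{n-1}(-1)^i\bar c(g_1,\dots,g_ig_{i+1},\dots,g_n)+(-1)^n\bar c(g_1,\dots,g_{n-1}).$$ If $n>d$, $\bar C^n_{(d)}(G,\nu)$ is the set of $\bar c\in\bar C^n(G)$ for which there are $C,D\ge0$ such that for all $g_1,\dots,g_n\in G$ $$|\bar c(g_1,\dots,g_n)|\le C\cdot\min_{I\subset\{1,\dots,n\},\,\#I=n-d}\ \sum_{i\in I}\nu(g_i)+D;$$ if $d\ge n$, $\bar C^n_{(d)}(G,\nu)$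 is the set of bounded cochains. $H^n_{(d)}(G,\nu)$ is the cohomology of the complex $(\bar C^\bullet_{(d)}(G,\nu),\bar\delta)$. The pullback of $\bar c\in\bar C^n(H)$ along $\phi:G\to H$ is $(\phi^*\bar c)(g_1,\dots,g_n)=\bar c(\phi(g_1),\dots,\phi(g_n))$. *)

theory Defs
  imports
    "HOL-Analysis.Analysis"
    "HOL-Algebra.AbelCoset"
    "Jordan_Normal_Form.VS_Connect"
begin

text \<open>
  Categories are given by families of hom-sets: \<open>Hom C X Y\<close> is the set of morphisms from
  \<open>X\<close> to \<open>Y\<close>, and \<open>Comp C X Y Z g f\<close> is the composite of \<open>f\<close> from \<open>X\<close> to \<open>Y\<close> with \<open>g\<close> from
  \<open>Y\<close> to \<open>Z\<close>. The hom-sets need not be disjoint, so the operations take the objects as arguments.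
\<close>

record ('o, 'm) category =
  Obj :: "'o set"
  Hom :: "'o \<Rightarrow> 'o \<Rightarrow> 'm set"
  Ident :: "'o \<Rightarrow> 'm"
  Comp :: "'o \<Rightarrow> 'o \<Rightarrow> 'o \<Rightarrow> 'm \<Rightarrow> 'm \<Rightarrow> 'm"

locale category =
  fixes C :: "('o, 'm) category"
  assumes Ident_in_Hom: "X \<in> Obj C \<Longrightarrow> Ident C X \<in> Hom C X X"
    and Comp_in_Hom:
      "\<lbrakk>X \<in> Obj C; Y \<in> Obj C; Z \<in> Obj C; f \<in> Hom C X Y; g \<in> Hom C Y Z\<rbrakk>
        \<Longrightarrow> Comp C X Y Z g f \<in> Hom C X Z"
    and Comp_Ident_right:
      "\<lbrakk>X \<in> Obj C; Y \<in> Obj C; f \<in> Hom C X Y\<rbrakk> \<Longrightarrow> Comp C X X Y f (Ident C X) = f"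
    and Comp_Ident_left:
      "\<lbrakk>X \<in> Obj C; Y \<in> Obj C; f \<in> Hom C X Y\<rbrakk> \<Longrightarrow> Comp C X Y Y (Ident C Y) f = f"
    and Comp_assoc:
      "\<lbrakk>W \<in> Obj C; X \<in> Obj C; Y \<in> Obj C; Z \<in> Obj C;
        f \<in> Hom C W X; g \<in> Hom C X Y; h \<in> Hom C Y Z\<rbrakk>
        \<Longrightarrow> Comp C W X Z (Comp C X Y Z h g) f = Comp C W Y Z h (Comp C W X Y g f)"

locale contravariant_functor = source: category C + target: category D
  for C :: "('o, 'm) category" and D :: "('p, 'k) category" +
  fixes F_obj :: "'o \<Rightarrow> 'p" and F_mor :: "'o \<Rightarrow> 'o \<Rightarrow> 'm \<Rightarrow> 'k"
  assumes F_obj_in_Obj: "X \<in> Obj C \<Longrightarrow> F_obj X \<in> Obj D"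
    and F_mor_in_Hom:
      "\<lbrakk>X \<in> Obj C; Y \<in> Obj C; f \<in> Hom C X Y\<rbrakk>
        \<Longrightarrow> F_mor X Y f \<in> Hom D (F_obj Y) (F_obj X)"
    and F_mor_Ident: "X \<in> Obj C \<Longrightarrow> F_mor X X (Ident C X) = Ident D (F_obj X)"
    and F_mor_Comp:
      "\<lbrakk>X \<in> Obj C; Y \<in> Obj C; Z \<in> Obj C; f \<in> Hom C X Y; g \<in> Hom C Y Z\<rbrakk>
        \<Longrightarrow> F_mor X Z (Comp C X Y Z g f)
          = Comp D (F_obj Z) (F_obj Y) (F_obj X) (F_mor X Y f) (F_mor Y Z g)"

text \<open>
  Maps between carriers are extensional, that is, \<open>undefined\<close> off the domain, so that two
  morphisms agreeing on the domain are equal.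
\<close>

definition Vect_R :: "((real, 'v) module, 'v \<Rightarrow> 'v) category" where
  "Vect_R = \<lparr>Obj = {V. vectorspace class_ring V},
    Hom = (\<lambda>V W. module_hom class_ring V W \<inter> extensional (carrier V)),
    Ident = (\<lambda>V. \<lambda>v\<in>carrier V. v),
    Comp = (\<lambda>U V W g f. compose (carrier U) g f)\<rparr>"

locale normed_group = group G for G :: "'a monoid" (structure) +
  fixes \<nu> :: "'a \<Rightarrow> real"
  assumes norm_nonneg: "g \<in> carrier G \<Longrightarrow> 0 \<le> \<nu> g"
    and norm_mult: "\<lbrakk>g \<in> carrier G; h \<in> carrier G\<rbrakk> \<Longrightarrow> \<nu> (g \<otimes> h) \<le> \<nu> g + \<nu> h"
    and norm_inv: "g \<in> carrier G \<Longrightarrow> \<nu> (inv g) = \<nu> g"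
    and norm_one: "\<nu> \<one> = 0"

definition lipschitz_hom ::
  "'a monoid \<Rightarrow> ('a \<Rightarrow> real) \<Rightarrow> 'b monoid \<Rightarrow> ('b \<Rightarrow> real) \<Rightarrow> ('a \<Rightarrow> 'b) set" where
  "lipschitz_hom G \<nu> H \<mu> =
    {\<phi> \<in> hom G H. \<exists>C\<ge>0. \<exists>D\<ge>0. \<forall>g\<in>carrier G. \<mu> (\<phi> g) \<le> C * \<nu> g + D}"

definition NGrp :: "('a monoid \<times> ('a \<Rightarrow> real), 'a \<Rightarrow> 'a) category" where
  "NGrp = \<lparr>Obj = {(G, \<nu>). normed_group G \<nu>},
    Hom = (\<lambda>(G, \<nu>) (H, \<mu>). lipschitz_hom G \<nu> H \<mu> \<inter> extensional (carrier G)),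
    Ident = (\<lambda>(G, \<nu>). \<lambda>g\<in>carrier G. g),
    Comp = (\<lambda>(G, _) _ _. \<lambda>\<psi> \<phi>. compose (carrier G) \<psi> \<phi>)\<rparr>"

definition tuples :: "'a monoid \<Rightarrow> nat \<Rightarrow> (nat \<Rightarrow> 'a) set" where
  "tuples G n = {1..n} \<rightarrow>\<^sub>E carrier G"

definition cochains :: "nat \<Rightarrow> 'a monoid \<Rightarrow> ((nat \<Rightarrow> 'a) \<Rightarrow> real) set" where
  "cochains n G = tuples G n \<rightarrow>\<^sub>E UNIV"

definition coboundary ::
  "nat \<Rightarrow> 'a monoid \<Rightarrow> ((nat \<Rightarrow> 'a) \<Rightarrow> real) \<Rightarrow> ((nat \<Rightarrow> 'a) \<Rightarrow> real)" where
  \<comment> \<open>The coboundary from degree \<open>n\<close> to degree \<open>n + 1\<close>.\<close>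
  "coboundary n G c = (\<lambda>g\<in>tuples G (n + 1).
      c (\<lambda>j\<in>{1..n}. g (j + 1))
    + (\<Sum>i = 1..n. (-1) ^ i *
        c (\<lambda>j\<in>{1..n}. if j < i then g j
                      else if j = i then g i \<otimes>\<^bsub>G\<^esub> g (i + 1)
                      else g (j + 1)))
    + (-1) ^ (n + 1) * c (\<lambda>j\<in>{1..n}. g j))"

definition cochains_d ::
  "nat \<Rightarrow> nat \<Rightarrow> 'a monoid \<Rightarrow> ('a \<Rightarrow> real) \<Rightarrow> ((nat \<Rightarrow> 'a) \<Rightarrow> real) set" where
  "cochains_d n d G \<nu> =
    (if n > d then
       {c \<in> cochains n G. \<exists>C\<ge>0. \<exists>D\<ge>0. \<forall>g\<in>tuples G n.
          \<bar>c g\<bar> \<le> C * (MIN I \<in> {I. I \<subseteq> {1..n} \<and> card I = n - d}. \<Sum>i\<in>I. \<nu> (g i)) + D}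
     else {c \<in> cochains n G. bounded (c ` tuples G n)})"

text \<open>
  The record type of modules extends that of rings; its fields \<open>mult\<close> and \<open>one\<close> play no role for
  vector spaces and are left unspecified here and below.
\<close>

definition cochain_space ::
  "nat \<Rightarrow> nat \<Rightarrow> 'a monoid \<Rightarrow> ('a \<Rightarrow> real) \<Rightarrow> (real, (nat \<Rightarrow> 'a) \<Rightarrow> real) module" where
  "cochain_space n d G \<nu> = \<lparr>carrier = cochains_d n d G \<nu>, mult = undefined, one = undefined,
    zero = (\<lambda>g\<in>tuples G n. 0),
    add = (\<lambda>b c. \<lambda>g\<in>tuples G n. b g + c g),
    smult = (\<lambda>a c. \<lambda>g\<in>tuples G n. a * c g)\<rparr>"

definition quotient_module :: "('r, 'v) module \<Rightarrow> 'v set \<Rightarrow> ('r, 'v set) module" where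
  "quotient_module M N = \<lparr>carrier = a_rcosets\<^bsub>M\<^esub> N, mult = undefined, one = undefined,
    zero = N,
    add = set_add M,
    smult = (\<lambda>a X. \<Union>x\<in>X. N +>\<^bsub>M\<^esub> (a \<odot>\<^bsub>M\<^esub> x))\<rparr>"

definition cocycles_d ::
  "nat \<Rightarrow> nat \<Rightarrow> 'a monoid \<Rightarrow> ('a \<Rightarrow> real) \<Rightarrow> ((nat \<Rightarrow> 'a) \<Rightarrow> real) set" where
  "cocycles_d n d G \<nu> =
    a_kernel (cochain_space n d G \<nu>) (cochain_space (n + 1) d G \<nu>) (coboundary n G)"

definition coboundaries_d ::
  "nat \<Rightarrow> nat \<Rightarrow> 'a monoid \<Rightarrow> ('a \<Rightarrow> real) \<Rightarrow> ((nat \<Rightarrow> 'a) \<Rightarrow> real) set" where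
  "coboundaries_d n d G \<nu> =
    (case n of 0 \<Rightarrow> {\<zero>\<^bsub>cochain_space 0 d G \<nu>\<^esub>}
     | Suc m \<Rightarrow> coboundary m G ` carrier (cochain_space m d G \<nu>))"

definition cohomology ::
  "nat \<Rightarrow> nat \<Rightarrow> 'a monoid \<Rightarrow> ('a \<Rightarrow> real) \<Rightarrow> (real, ((nat \<Rightarrow> 'a) \<Rightarrow> real) set) module" where
  "cohomology n d G \<nu> =
    quotient_module ((cochain_space n d G \<nu>)\<lparr>carrier := cocycles_d n d G \<nu>\<rparr>)
      (coboundaries_d n d G \<nu>)"

definition pullback ::
  "nat \<Rightarrow> 'a monoid \<Rightarrow> ('a \<Rightarrow> 'b) \<Rightarrow> ((nat \<Rightarrow> 'b) \<Rightarrow> real) \<Rightarrow> ((nat \<Rightarrow> 'a) \<Rightarrow> real)" where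
  "pullback n G \<phi> c = (\<lambda>g\<in>tuples G n. c (\<lambda>i\<in>{1..n}. \<phi> (g i)))"

text \<open>
  The map induced by \<open>\<phi>\<close> from \<open>G\<close> to \<open>H\<close> sends the class of \<open>c\<close> to the class of its pullback. The union
  runs over all representatives \<open>c\<close> of the class \<open>X\<close>; it is a single coset once the classes of
  their pullbacks agree.
\<close>

definition cohomology_map ::
  "nat \<Rightarrow> nat \<Rightarrow> 'a monoid \<Rightarrow> ('a \<Rightarrow> real) \<Rightarrow> 'b monoid \<Rightarrow> ('b \<Rightarrow> real) \<Rightarrow> ('a \<Rightarrow> 'b)
    \<Rightarrow> ((nat \<Rightarrow> 'b) \<Rightarrow> real) set \<Rightarrow> ((nat \<Rightarrow> 'a) \<Rightarrow> real) set" where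
  "cohomology_map n d G \<nu> H \<mu> \<phi> = (\<lambda>X\<in>carrier (cohomology n d H \<mu>).
    \<Union>c\<in>X. coboundaries_d n d G \<nu> +>\<^bsub>cochain_space n d G \<nu>\<^esub> pullback n G \<phi> c)"

end

theory Submission
  imports Defs
begin

text \<open>
  Cohomology is functorial because pullback along a Lipschitz homomorphism is a map of cochain
  complexes that respects the growth condition and the composition of homomorphisms. Three points
  need an argument.

  First, the controlled cochains form a complex. Writing the coboundary as the alternating sum over
  the \<open>n + 2\<close> faces of a tuple (\<open>coboundary_eq_sum_faces\<close>), its square vanishes by the simplicial
  identity \<open>face_face\<close>, whose only algebraic input is associativity. The growth condition survives
  because a face merges at most two neighbouring entries: any choice of \<open>n + 1 - d\<close> entries of the
  tuple controls \<open>n - d\<close> entries of each face (\<open>face_norm_sum_le\<close>). Here the minimum over index sets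
  is read as a bound for every index set, which treats the ranges \<open>n > d\<close> and \<open>n \<le> d\<close> alike
  (\<open>cochains_d_iff\<close>).

  Second, pullback commutes with faces since it comes from a homomorphism, hence with coboundaries
  (\<open>pullback_coboundary\<close>), and the Lipschitz estimate turns control by the norm of the target into
  control by the norm of the source (\<open>pullback_in_cochains_d\<close>).

  Third, the quotient of a module by a submodule is a module, and a homomorphism that respects the
  submodules descends to the quotients, where it acts on representatives (\<open>module_quotient_module\<close>,
  \<open>induced_map_coset\<close>). The functor laws are then inherited from those of pullback on cochains.
\<close>

section \<open>Quotients of modules\<close>

lemma submodule_imp_abelian_subgroup:
  assumes "submodule R N M"
  shows "abelian_subgroup N M"
proof -
  interpret N: submodule R N M by fact
  interpret M: module R M by (rule N.module)
  have "subgroup N (add_monoid M)"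
  proof (rule M.add.subgroupI)
    show "\<ominus>\<^bsub>M\<^esub> x \<in> N" if "x \<in> N" for x
      using that N.subset N.smult_closed[of "\<ominus>\<^bsub>R\<^esub> \<one>\<^bsub>R\<^esub>" x]
      by (auto simp: M.smult_l_minus subset_iff)
    show "N \<noteq> {}"
      using N.zero_closed by blast
  qed (use N.subset in auto)
  then show ?thesis
    by (intro abelian_subgroupI3 additive_subgroupI M.abelian_group_axioms)
qed

lemma submodule_of_submodule:
  assumes "submodule R N M" "submodule R Z M" "N \<subseteq> Z"
  shows "submodule R N (M\<lparr>carrier := Z\<rparr>)"
  using assms module.submodule_is_module[OF submodule.module[OF assms(2)] assms(2)]
  by (auto simp: submodule_def)

lemma a_r_coset_carrier_update [simp]: "N +>\<^bsub>M\<lparr>carrier := Z\<rparr>\<^esub> x = N +>\<^bsub>M\<^esub> x"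
  by (simp add: a_r_coset_def')

lemma carrier_quotient_module:
  "carrier (quotient_module M N) = {N +>\<^bsub>M\<^esub> x |x. x \<in> carrier M}"
  by (auto simp: quotient_module_def A_RCOSETS_def')

lemma a_r_coset_in_quotient_module:
  "x \<in> carrier M \<Longrightarrow> N +>\<^bsub>M\<^esub> x \<in> carrier (quotient_module M N)"
  unfolding carrier_quotient_module by blast

lemma quotient_moduleE:
  assumes "X \<in> carrier (quotient_module M N)"
  obtains x where "x \<in> carrier M" "X = N +>\<^bsub>M\<^esub> x"
  using assms unfolding carrier_quotient_module by blast

lemma add_quotient_module:
  assumes "submodule R N M" "x \<in> carrier M" "y \<in> carrier M"
  shows "(N +>\<^bsub>M\<^esub> x) \<oplus>\<^bsub>quotient_module M N\<^esub> (N +>\<^bsub>M\<^esub> y) = N +>\<^bsub>M\<^esub> (x \<oplus>\<^bsub>M\<^esub> y)"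
  using abelian_subgroup.a_rcos_sum[OF submodule_imp_abelian_subgroup] assms
  by (simp add: quotient_module_def)

text \<open>
  The multiple of a coset is a union over all its elements. Since \<open>N\<close> is stable under scalars,
  congruent elements have congruent multiples, so all sets in the union are the same coset. This
  also covers the scalar zero, where the set of multiples itself would be too small.
\<close>

lemma smult_quotient_module:
  assumes N: "submodule R N M" and a: "a \<in> carrier R" and x: "x \<in> carrier M"
  shows "a \<odot>\<^bsub>quotient_module M N\<^esub> (N +>\<^bsub>M\<^esub> x) = N +>\<^bsub>M\<^esub> (a \<odot>\<^bsub>M\<^esub> x)"
proof -
  interpret N: submodule R N M by fact
  interpret M: module R M by (rule N.module)
  interpret A: abelian_subgroup N M by (rule submodule_imp_abelian_subgroup[OF N])
  have "N +>\<^bsub>M\<^esub> (a \<odot>\<^bsub>M\<^esub> y) = N +>\<^bsub>M\<^esub> (a \<odot>\<^bsub>M\<^esub> x)" if y: "y \<in> N +>\<^bsub>M\<^esub> x" for y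
  proof -
    obtain h where h: "h \<in> N" "y = h \<oplus>\<^bsub>M\<^esub> x"
      using y by (auto simp: a_r_coset_def')
    then have "a \<odot>\<^bsub>M\<^esub> y = a \<odot>\<^bsub>M\<^esub> h \<oplus>\<^bsub>M\<^esub> a \<odot>\<^bsub>M\<^esub> x"
      using a x N.subset by (auto simp: M.smult_r_distr subset_iff)
    then have "a \<odot>\<^bsub>M\<^esub> y \<in> N +>\<^bsub>M\<^esub> (a \<odot>\<^bsub>M\<^esub> x)"
      using a h by (auto simp: a_r_coset_def')
    then show ?thesis
      using a x by (intro A.a_repr_independence'[symmetric]) auto
  qed
  moreover have "x \<in> N +>\<^bsub>M\<^esub> x"
    using x by (rule A.a_rcos_self)
  ultimately have "(\<Union>y\<in>N +>\<^bsub>M\<^esub> x. N +>\<^bsub>M\<^esub> (a \<odot>\<^bsub>M\<^esub> y)) = N +>\<^bsub>M\<^esub> (a \<odot>\<^bsub>M\<^esub> x)"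
    by (intro SUP_eq_const) blast+
  then show ?thesis
    by (simp add: quotient_module_def)
qed

lemma module_quotient_module:
  assumes N: "submodule R N M"
  shows "module R (quotient_module M N)"
proof -
  let ?Q = "quotient_module M N"
  interpret N: submodule R N M by fact
  interpret M: module R M by (rule N.module)
  note add = add_quotient_module[OF N] and smult = smult_quotient_module[OF N]
  have zero: "\<zero>\<^bsub>?Q\<^esub> = N +>\<^bsub>M\<^esub> \<zero>\<^bsub>M\<^esub>"
    using N.subset by (simp add: quotient_module_def M.a_coset_add_zero)
  have "abelian_group ?Q"
  proof (rule abelian_groupI)
    show "X \<oplus>\<^bsub>?Q\<^esub> Y \<in> carrier ?Q" if "X \<in> carrier ?Q" "Y \<in> carrier ?Q" for X Y
      using that by (elim quotient_moduleE) (simp add: add a_r_coset_in_quotient_module)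
    show "X \<oplus>\<^bsub>?Q\<^esub> Y \<oplus>\<^bsub>?Q\<^esub> Z = X \<oplus>\<^bsub>?Q\<^esub> (Y \<oplus>\<^bsub>?Q\<^esub> Z)"
      if "X \<in> carrier ?Q" "Y \<in> carrier ?Q" "Z \<in> carrier ?Q" for X Y Z
      using that by (elim quotient_moduleE) (simp add: add M.a_assoc)
    show "X \<oplus>\<^bsub>?Q\<^esub> Y = Y \<oplus>\<^bsub>?Q\<^esub> X" if "X \<in> carrier ?Q" "Y \<in> carrier ?Q" for X Y
      using that by (elim quotient_moduleE) (simp add: add M.a_comm)
    show "\<zero>\<^bsub>?Q\<^esub> \<oplus>\<^bsub>?Q\<^esub> X = X" if "X \<in> carrier ?Q" for X
      using that by (elim quotient_moduleE) (simp add: zero add)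
    show "\<exists>Y\<in>carrier ?Q. Y \<oplus>\<^bsub>?Q\<^esub> X = \<zero>\<^bsub>?Q\<^esub>" if "X \<in> carrier ?Q" for X
      using that
    proof (rule quotient_moduleE)
      fix x assume "x \<in> carrier M" "X = N +>\<^bsub>M\<^esub> x"
      then show ?thesis
        by (intro bexI[of _ "N +>\<^bsub>M\<^esub> (\<ominus>\<^bsub>M\<^esub> x)"])
          (simp_all add: zero add M.l_neg a_r_coset_in_quotient_module)
    qed
  qed (simp add: zero a_r_coset_in_quotient_module)
  moreover have "module_axioms R ?Q"
  proof
    show "(a \<oplus>\<^bsub>R\<^esub> b) \<odot>\<^bsub>?Q\<^esub> X = a \<odot>\<^bsub>?Q\<^esub> X \<oplus>\<^bsub>?Q\<^esub> b \<odot>\<^bsub>?Q\<^esub> X"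
      if "a \<in> carrier R" "b \<in> carrier R" "X \<in> carrier ?Q" for a b X
      using that by (elim quotient_moduleE) (simp add: add smult M.smult_l_distr)
    show "a \<odot>\<^bsub>?Q\<^esub> (X \<oplus>\<^bsub>?Q\<^esub> Y) = a \<odot>\<^bsub>?Q\<^esub> X \<oplus>\<^bsub>?Q\<^esub> a \<odot>\<^bsub>?Q\<^esub> Y"
      if "a \<in> carrier R" "X \<in> carrier ?Q" "Y \<in> carrier ?Q" for a X Y
      using that by (elim quotient_moduleE) (simp add: add smult M.smult_r_distr)
    show "(a \<otimes>\<^bsub>R\<^esub> b) \<odot>\<^bsub>?Q\<^esub> X = a \<odot>\<^bsub>?Q\<^esub> (b \<odot>\<^bsub>?Q\<^esub> X)"
      if "a \<in> carrier R" "b \<in> carrier R" "X \<in> carrier ?Q" for a b X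
      using that by (elim quotient_moduleE) (simp add: smult M.smult_assoc1)
    show "a \<odot>\<^bsub>?Q\<^esub> X \<in> carrier ?Q" if "a \<in> carrier R" "X \<in> carrier ?Q" for a X
      using that by (elim quotient_moduleE) (simp add: smult a_r_coset_in_quotient_module)
    show "\<one>\<^bsub>R\<^esub> \<odot>\<^bsub>?Q\<^esub> X = X" if "X \<in> carrier ?Q" for X
      using that by (elim quotient_moduleE) (simp add: smult)
  qed
  ultimately show ?thesis
    by (intro module.intro M.R.cring_axioms)
qed

text \<open>
  A homomorphism \<open>f\<close> that maps \<open>N\<close> into \<open>N'\<close> descends to the quotients: all elements of one coset
  of \<open>N\<close> are sent into the same coset of \<open>N'\<close>, so the union below collapses.
\<close>

lemma induced_map_coset:
  assumes N: "submodule R N M" and N': "submodule R N' M'"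
    and f: "f \<in> module_hom R M M'" and fN: "f ` N \<subseteq> N'" and x: "x \<in> carrier M"
  shows "(\<Union>y\<in>N +>\<^bsub>M\<^esub> x. N' +>\<^bsub>M'\<^esub> f y) = N' +>\<^bsub>M'\<^esub> f x"
proof -
  interpret N: submodule R N M by fact
  interpret A: abelian_subgroup N M by (rule submodule_imp_abelian_subgroup[OF N])
  interpret A': abelian_subgroup N' M' by (rule submodule_imp_abelian_subgroup[OF N'])
  have fx: "f x \<in> carrier M'"
    using module_hom_closed[OF f] x by auto
  have "N' +>\<^bsub>M'\<^esub> f y = N' +>\<^bsub>M'\<^esub> f x" if y: "y \<in> N +>\<^bsub>M\<^esub> x" for y
  proof -
    obtain h where h: "h \<in> N" "y = h \<oplus>\<^bsub>M\<^esub> x"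
      using y by (auto simp: a_r_coset_def')
    then have "f y = f h \<oplus>\<^bsub>M'\<^esub> f x"
      using x N.subset by (auto intro: module_hom_add[OF f])
    then have "f y \<in> N' +>\<^bsub>M'\<^esub> f x"
      using h fN by (auto simp: a_r_coset_def')
    then show ?thesis
      using fx by (intro A'.a_repr_independence'[symmetric])
  qed
  moreover have "x \<in> N +>\<^bsub>M\<^esub> x"
    using x by (rule A.a_rcos_self)
  ultimately show ?thesis
    by (intro SUP_eq_const) blast+
qed

lemma induced_module_hom:
  assumes N: "submodule R N M" and N': "submodule R N' M'"
    and f: "f \<in> module_hom R M M'" and fN: "f ` N \<subseteq> N'"
  shows "(\<lambda>X\<in>carrier (quotient_module M N). \<Union>y\<in>X. N' +>\<^bsub>M'\<^esub> f y)
    \<in> module_hom R (quotient_module M N) (quotient_module M' N')"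
proof -
  let ?Q = "quotient_module M N" and ?Q' = "quotient_module M' N'"
  interpret M: module R M by (rule submodule.module[OF N])
  define F where "F = (\<lambda>X\<in>carrier ?Q. \<Union>y\<in>X. N' +>\<^bsub>M'\<^esub> f y)"
  have closed: "f x \<in> carrier M'" if "x \<in> carrier M" for x
    using module_hom_closed[OF f] that by (rule funcset_mem)
  have F: "F (N +>\<^bsub>M\<^esub> x) = N' +>\<^bsub>M'\<^esub> f x" if x: "x \<in> carrier M" for x
    unfolding F_def
    by (simp only: restrict_apply a_r_coset_in_quotient_module[OF x] if_True
        induced_map_coset[OF N N' f fN x])
  have "F \<in> module_hom R ?Q ?Q'"
    unfolding module_hom_def
  proof (intro CollectI conjI allI impI funcsetI; (elim conjE)?)
    show "F X \<in> carrier ?Q'" if "X \<in> carrier ?Q" for X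
      using that by (elim quotient_moduleE) (simp add: F closed a_r_coset_in_quotient_module)
    show "F (X \<oplus>\<^bsub>?Q\<^esub> Y) = F X \<oplus>\<^bsub>?Q'\<^esub> F Y" if "X \<in> carrier ?Q" "Y \<in> carrier ?Q" for X Y
      using that
      by (elim quotient_moduleE) (simp add: F add_quotient_module[OF N]
          add_quotient_module[OF N'] closed module_hom_add[OF f])
    show "F (a \<odot>\<^bsub>?Q\<^esub> X) = a \<odot>\<^bsub>?Q'\<^esub> F X" if "a \<in> carrier R" "X \<in> carrier ?Q" for a X
      using that
      by (elim quotient_moduleE) (simp add: F smult_quotient_module[OF N]
          smult_quotient_module[OF N'] closed module_hom_smult[OF f])
  qed
  then show ?thesis
    by (simp only: F_def)
qed

section \<open>Faces of tuples\<close>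

text \<open>
  The inner faces multiply two neighbouring entries; for \<open>i = 0\<close> and \<open>i = n + 1\<close> the same formula
  drops the first and the last entry, because no index \<open>j\<close> in \<open>{1..n}\<close> is then equal to \<open>i\<close>.
\<close>

definition face :: "nat \<Rightarrow> 'a monoid \<Rightarrow> nat \<Rightarrow> (nat \<Rightarrow> 'a) \<Rightarrow> (nat \<Rightarrow> 'a)" where
  "face n G i g = (\<lambda>j\<in>{1..n}. if j < i then g j
      else if j = i then g i \<otimes>\<^bsub>G\<^esub> g (i + 1) else g (j + 1))"

lemma tuples_nth: "g \<in> tuples G n \<Longrightarrow> j \<in> {1..n} \<Longrightarrow> g j \<in> carrier G"
  by (auto simp: tuples_def)

lemma coboundary_eq_sum_faces:
  assumes "g \<in> tuples G (n + 1)"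
  shows "coboundary n G c g = (\<Sum>i\<le>n + 1. (-1) ^ i * c (face n G i g))"
proof -
  have first: "face n G 0 g = (\<lambda>j\<in>{1..n}. g (j + 1))"
    and last: "face n G (n + 1) g = (\<lambda>j\<in>{1..n}. g j)"
    by (auto simp: face_def fun_eq_iff)
  have "{..n} = insert 0 {1..n}"
    by auto
  then have "(\<Sum>i\<le>n + 1. (-1) ^ i * c (face n G i g)) =
      c (face n G 0 g) + (\<Sum>i = 1..n. (-1) ^ i * c (face n G i g))
      + (-1) ^ (n + 1) * c (face n G (n + 1) g)"
    by simp
  then show ?thesis
    using assms unfolding first last by (simp add: coboundary_def face_def)
qed

lemma face_in_tuples:
  assumes "monoid G" "g \<in> tuples G (n + 1)" "i \<le> n + 1"
  shows "face n G i g \<in> tuples G n"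
  using monoid.m_closed[OF assms(1)] tuples_nth[OF assms(2)] assms(3)
  by (auto simp: face_def tuples_def)

text \<open>
  The only case of the simplicial identity that uses the group law is \<open>j = i + 1\<close>, where both sides
  multiply the same three neighbouring entries: there it is associativity.
\<close>

lemma face_face:
  assumes G: "monoid G" and g: "g \<in> tuples G (n + 2)" and "i < j" "j \<le> n + 2"
  shows "face n G i (face (n + 1) G j g) = face n G (j - 1) (face (n + 1) G i g)"
proof
  fix k
  show "face n G i (face (n + 1) G j g) k = face n G (j - 1) (face (n + 1) G i g) k"
  proof (cases "k \<in> {1..n}")
    case k: True
    have assoc: "g k \<otimes>\<^bsub>G\<^esub> g (Suc k) \<otimes>\<^bsub>G\<^esub> g (Suc (Suc k)) = g k \<otimes>\<^bsub>G\<^esub> (g (Suc k) \<otimes>\<^bsub>G\<^esub> g (Suc (Suc k)))"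
      using k by (intro monoid.m_assoc[OF G] tuples_nth[OF g]) auto
    consider "k < i" | "k = i" "j = i + 1" | "k = i" "i + 1 < j" | "i < k" "k < j - 1"
      | "i < k" "k = j - 1" | "j \<le> k"
      using \<open>i < j\<close> by linarith
    then show ?thesis
      using k assoc \<open>i < j\<close> \<open>j \<le> n + 2\<close> by cases (auto simp: face_def)
  next
    case False
    then show ?thesis
      by (simp only: face_def restrict_apply if_False)
  qed
qed

text \<open>
  By the simplicial identity the term at the pair \<open>(i, k)\<close> with \<open>k < i\<close> is, up to sign, the term at
  \<open>(k, i - 1)\<close>. This matches the pairs with \<open>k < i\<close> with those with \<open>i \<le> k\<close>, and lowering one index
  by one flips the sign, so that everything cancels.
\<close>

lemma coboundary_coboundary:
  assumes G: "monoid G"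
  shows "coboundary (n + 1) G (coboundary n G c) = (\<lambda>g\<in>tuples G (n + 2). 0)"
proof
  fix g
  show "coboundary (n + 1) G (coboundary n G c) g = (\<lambda>g\<in>tuples G (n + 2). 0) g"
  proof (cases "g \<in> tuples G (n + 2)")
    case g: True
    define t where "t i k = (-1) ^ (i + k) * c (face n G k (face (n + 1) G i g))" for i k
    let ?L = "{(i, k). i \<le> n + 2 \<and> k \<le> n + 1 \<and> k < i}"
    let ?U = "{(i, k). i \<le> n + 2 \<and> k \<le> n + 1 \<and> i \<le> k}"
    have fin: "finite ?L" "finite ?U"
      by (rule finite_subset[of _ "{..n + 2} \<times> {..n + 1}"]; auto)+
    have "coboundary (n + 1) G (coboundary n G c) g
        = (\<Sum>i\<le>n + 2. (-1) ^ i * coboundary n G c (face (n + 1) G i g))"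
      using coboundary_eq_sum_faces[of g G "n + 1"] g by simp
    also have "\<dots> = (\<Sum>i\<le>n + 2. \<Sum>k\<le>n + 1. t i k)"
    proof (intro sum.cong refl)
      fix i assume "i \<in> {..n + 2}"
      then have "face (n + 1) G i g \<in> tuples G (n + 1)"
        using g by (intro face_in_tuples G) auto
      then show "(-1) ^ i * coboundary n G c (face (n + 1) G i g) = (\<Sum>k\<le>n + 1. t i k)"
        by (simp only: coboundary_eq_sum_faces sum_distrib_left t_def power_add mult.assoc)
    qed
    also have "\<dots> = (\<Sum>(i, k)\<in>{..n + 2} \<times> {..n + 1}. t i k)"
      by (rule sum.cartesian_product)
    also have "{..n + 2} \<times> {..n + 1} = ?L \<union> ?U"
      by auto
    also have "(\<Sum>(i, k)\<in>?L \<union> ?U. t i k) = (\<Sum>(i, k)\<in>?L. t i k) + (\<Sum>(i, k)\<in>?U. t i k)"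
      by (rule sum.union_disjoint) (use fin in auto)
    also have "(\<Sum>(i, k)\<in>?L. t i k) = (\<Sum>(i, k)\<in>?U. - t i k)"
    proof (rule sum.reindex_bij_witness[where i = "\<lambda>(i, k). (k + 1, i)"
          and j = "\<lambda>(i, k). (k, i - 1)"])
      fix p assume "p \<in> ?L"
      then obtain i k where p: "p = (i, k)" "i \<le> n + 2" "k \<le> n + 1" "k < i"
        by auto
      then obtain m where m: "i = Suc m"
        by (cases i) auto
      show "(case case p of (i, k) \<Rightarrow> (k, i - 1) of (i, k) \<Rightarrow> - t i k) = (case p of (i, k) \<Rightarrow> t i k)"
        using face_face[OF G g, of k i] p by (simp add: t_def m add.commute)
    qed auto
    finally show ?thesis
      using g by (simp add: sum_negf case_prod_unfold)
  qed (simp add: coboundary_def)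
qed

section \<open>Cochains of controlled growth\<close>

lemma le_mult_MIN_iff:
  fixes x C D :: real
  assumes "finite S" "S \<noteq> {}" "0 \<le> C"
  shows "x \<le> C * (MIN I\<in>S. f I) + D \<longleftrightarrow> (\<forall>I\<in>S. x \<le> C * f I + D)"
proof
  assume x: "x \<le> C * (MIN I\<in>S. f I) + D"
  have "C * (MIN I\<in>S. f I) \<le> C * f I" if "I \<in> S" for I
    using assms that by (intro mult_left_mono Min_le) auto
  then show "\<forall>I\<in>S. x \<le> C * f I + D"
    using x by fastforce
next
  assume x: "\<forall>I\<in>S. x \<le> C * f I + D"
  have "(MIN I\<in>S. f I) \<in> f ` S"
    using assms by (intro Min_in) auto
  then show "x \<le> C * (MIN I\<in>S. f I) + D"
    using x by auto
qed

text \<open>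
  A bound by the minimum is a bound by each competitor. With truncated subtraction this covers
  bounded cochains as well: for \<open>n \<le> d\<close> the only competitor is the empty sum.
\<close>

lemma cochains_d_iff:
  "c \<in> cochains_d n d G \<nu> \<longleftrightarrow> c \<in> extensional (tuples G n) \<and>
    (\<exists>C\<ge>0. \<exists>D\<ge>0. \<forall>g\<in>tuples G n. \<forall>I\<in>{I. I \<subseteq> {1..n} \<and> card I = n - d}.
      \<bar>c g\<bar> \<le> C * (\<Sum>i\<in>I. \<nu> (g i)) + D)"
proof (cases "n > d")
  case True
  let ?S = "{I. I \<subseteq> {1..n} \<and> card I = n - d}"
  have "finite ?S"
    by (rule finite_subset[of _ "Pow {1..n}"]) auto
  moreover have "{1..n - d} \<in> ?S"
    by auto
  then have "?S \<noteq> {}"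
    by blast
  ultimately have "x \<le> C * (MIN I\<in>?S. f I) + D \<longleftrightarrow> (\<forall>I\<in>?S. x \<le> C * f I + D)"
    if "0 \<le> C" for x C D :: real and f
    using that by (intro le_mult_MIN_iff)
  then show ?thesis
    using True by (simp add: cochains_d_def cochains_def PiE_def cong: conj_cong)
next
  case False
  have S: "{I. I \<subseteq> {1..n} \<and> card I = n - d} = {{}}"
    using False by (auto simp: finite_subset[of _ "{1..n}"])
  have "bounded (c ` tuples G n) \<longleftrightarrow> (\<exists>D\<ge>0. \<forall>g\<in>tuples G n. \<bar>c g\<bar> \<le> D)"
  proof
    assume "bounded (c ` tuples G n)"
    then obtain D where "\<forall>g\<in>tuples G n. \<bar>c g\<bar> \<le> D"
      by (auto simp: bounded_iff)
    then show "\<exists>D\<ge>0. \<forall>g\<in>tuples G n. \<bar>c g\<bar> \<le> D"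
      by (intro exI[of _ "\<bar>D\<bar>"]) fastforce
  qed (auto simp: bounded_iff)
  then show ?thesis
    using False unfolding S by (auto simp: cochains_d_def cochains_def PiE_def)
qed

lemma cochains_dI:
  assumes "c \<in> extensional (tuples G n)" "0 \<le> C" "0 \<le> D"
    and "\<And>g I. g \<in> tuples G n \<Longrightarrow> I \<subseteq> {1..n} \<Longrightarrow> card I = n - d \<Longrightarrow>
      \<bar>c g\<bar> \<le> C * (\<Sum>i\<in>I. \<nu> (g i)) + D"
  shows "c \<in> cochains_d n d G \<nu>"
  unfolding cochains_d_iff using assms by blast

lemma cochains_dE:
  assumes "c \<in> cochains_d n d G \<nu>"
  obtains C D where "0 \<le> C" "0 \<le> D"
    and "\<And>g I. g \<in> tuples G n \<Longrightarrow> I \<subseteq> {1..n} \<Longrightarrow> card I = n - d \<Longrightarrow>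
      \<bar>c g\<bar> \<le> C * (\<Sum>i\<in>I. \<nu> (g i)) + D"
  using assms unfolding cochains_d_iff by blast

lemma cochains_d_extensional: "c \<in> cochains_d n d G \<nu> \<Longrightarrow> c \<in> extensional (tuples G n)"
  by (simp add: cochains_d_iff)

lemma cochains_d_undefined: "c \<in> cochains_d n d G \<nu> \<Longrightarrow> g \<notin> tuples G n \<Longrightarrow> c g = undefined"
  by (rule extensional_arb[OF cochains_d_extensional])

lemma cochains_d_add:
  assumes "b \<in> cochains_d n d G \<nu>" "c \<in> cochains_d n d G \<nu>"
  shows "(\<lambda>g\<in>tuples G n. b g + c g) \<in> cochains_d n d G \<nu>"
proof -
  obtain B D where B: "0 \<le> B" "0 \<le> D" "\<And>g I. g \<in> tuples G n \<Longrightarrow> I \<subseteq> {1..n} \<Longrightarrow>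
      card I = n - d \<Longrightarrow> \<bar>b g\<bar> \<le> B * (\<Sum>i\<in>I. \<nu> (g i)) + D"
    using cochains_dE[OF assms(1)] by blast
  obtain C E where C: "0 \<le> C" "0 \<le> E" "\<And>g I. g \<in> tuples G n \<Longrightarrow> I \<subseteq> {1..n} \<Longrightarrow>
      card I = n - d \<Longrightarrow> \<bar>c g\<bar> \<le> C * (\<Sum>i\<in>I. \<nu> (g i)) + E"
    using cochains_dE[OF assms(2)] by blast
  show ?thesis
  proof (rule cochains_dI[where C = "B + C" and D = "D + E"])
    fix g I assume "g \<in> tuples G n" "I \<subseteq> {1..n}" "card I = n - d"
    then show "\<bar>(\<lambda>g\<in>tuples G n. b g + c g) g\<bar> \<le> (B + C) * (\<Sum>i\<in>I. \<nu> (g i)) + (D + E)"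
      using B(3)[of g I] C(3)[of g I] by (auto simp: algebra_simps)
  qed (use B C in auto)
qed

lemma cochains_d_smult:
  assumes "c \<in> cochains_d n d G \<nu>"
  shows "(\<lambda>g\<in>tuples G n. a * c g) \<in> cochains_d n d G \<nu>"
proof -
  obtain C D where C: "0 \<le> C" "0 \<le> D" "\<And>g I. g \<in> tuples G n \<Longrightarrow> I \<subseteq> {1..n} \<Longrightarrow>
      card I = n - d \<Longrightarrow> \<bar>c g\<bar> \<le> C * (\<Sum>i\<in>I. \<nu> (g i)) + D"
    using cochains_dE[OF assms] by blast
  show ?thesis
  proof (rule cochains_dI[where C = "\<bar>a\<bar> * C" and D = "\<bar>a\<bar> * D"])
    fix g I assume "g \<in> tuples G n" "I \<subseteq> {1..n}" "card I = n - d"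
    then show "\<bar>(\<lambda>g\<in>tuples G n. a * c g) g\<bar> \<le> \<bar>a\<bar> * C * (\<Sum>i\<in>I. \<nu> (g i)) + \<bar>a\<bar> * D"
      using mult_left_mono[OF C(3)[of g I], of "\<bar>a\<bar>"] by (simp add: abs_mult algebra_simps)
  qed (use C in auto)
qed

lemma cochains_d_zero: "(\<lambda>g\<in>tuples G n. 0) \<in> cochains_d n d G \<nu>"
  by (rule cochains_dI[where C = 0 and D = 0]) auto

lemma cochain_space_simps [simp]:
  "carrier (cochain_space n d G \<nu>) = cochains_d n d G \<nu>"
  "\<zero>\<^bsub>cochain_space n d G \<nu>\<^esub> = (\<lambda>g\<in>tuples G n. 0)"
  "b \<oplus>\<^bsub>cochain_space n d G \<nu>\<^esub> c = (\<lambda>g\<in>tuples G n. b g + c g)"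
  "a \<odot>\<^bsub>cochain_space n d G \<nu>\<^esub> c = (\<lambda>g\<in>tuples G n. a * c g)"
  by (simp_all add: cochain_space_def)

lemma module_cochain_space: "module class_ring (cochain_space n d G \<nu>)"
proof (rule moduleI)
  show "cring (class_ring :: real ring)"
    by (rule class_cring.cring_axioms)
  show "abelian_group (cochain_space n d G \<nu>)"
  proof (rule abelian_groupI)
    fix c assume c: "c \<in> carrier (cochain_space n d G \<nu>)"
    then have "(\<lambda>g\<in>tuples G n. - 1 * c g) \<in> carrier (cochain_space n d G \<nu>)"
      using cochains_d_smult[of c n d G \<nu> "- 1"] by simp
    then show "\<exists>b\<in>carrier (cochain_space n d G \<nu>).
        b \<oplus>\<^bsub>cochain_space n d G \<nu>\<^esub> c = \<zero>\<^bsub>cochain_space n d G \<nu>\<^esub>"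
      by (rule bexI[rotated]) (auto simp: fun_eq_iff)
    show "\<zero>\<^bsub>cochain_space n d G \<nu>\<^esub> \<oplus>\<^bsub>cochain_space n d G \<nu>\<^esub> c = c"
      using c by (simp add: fun_eq_iff cochains_d_undefined)
  qed (auto simp: cochains_d_add cochains_d_zero fun_eq_iff)
next
  fix c assume "c \<in> carrier (cochain_space n d G \<nu>)"
  then show "\<one>\<^bsub>class_ring\<^esub> \<odot>\<^bsub>cochain_space n d G \<nu>\<^esub> c = c"
    by (simp add: fun_eq_iff cochains_d_undefined)
qed (auto simp: cochains_d_smult fun_eq_iff algebra_simps)

text \<open>
  This is why the degree can go up by one while \<open>d\<close> stays fixed. The entry \<open>k\<close> of the \<open>i\<close>-th face
  is the product of the entries of \<open>g\<close> in the block of \<open>k\<close>, which is a single index except for the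
  block \<open>{i, i + 1}\<close> of \<open>i\<close>. Given \<open>J\<close>, keep the entries whose blocks lie inside \<open>J\<close>; by the triangle
  inequality they are controlled by \<open>J\<close>. There are at least \<open>card J - 1\<close> of them: an inner face
  loses an index only where \<open>J\<close> meets the one block of size two, and an outer face only if \<open>J\<close>
  contains the dropped index.
\<close>

lemma (in normed_group) face_norm_sum_le:
  assumes g: "g \<in> tuples G (n + 1)" and i: "i \<le> n + 1"
    and J: "J \<subseteq> {1..n + 1}" "card J = n + 1 - d"
  obtains I where "I \<subseteq> {1..n}" "card I = n - d"
    and "(\<Sum>k\<in>I. \<nu> (face n G i g k)) \<le> (\<Sum>j\<in>J. \<nu> (g j))"
proof -
  define block where
    "block k = (if k < i then {k} else if k = i then {i, i + 1} else {k + 1})" for k :: nat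
  define I0 where "I0 = {k \<in> {1..n}. block k \<subseteq> J}"
  \<comment> \<open>\<open>skip k\<close> picks an index from the block of \<open>k\<close>. Only the index \<open>e\<close> of \<open>J\<close> may fail to be
    picked: if \<open>J\<close> contains \<open>i\<close> and \<open>i + 1\<close>, then the block of \<open>i\<close> lies inside \<open>J\<close> and
    \<open>i + 1\<close> is picked from it.\<close>
  define skip where "skip k = (if k < i then k else k + 1)" for k
  define e where "e = (if i \<in> J then i else i + 1)"
  have fin: "finite J" "finite I0"
    using J(1) finite_subset by (auto simp: I0_def)
  have "J \<subseteq> insert e (skip ` I0)"
  proof
    fix j assume j: "j \<in> J"
    show "j \<in> insert e (skip ` I0)"
    proof (cases "j = e")
      case False
      define k where "k = (if j < i then j else j - 1)"
      have "j \<noteq> i"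
        using j False by (auto simp: e_def)
      then have "j < i \<or> i < j"
        by linarith
      then have "k \<in> I0" "j = skip k"
        using j J(1) i False by (auto simp: k_def I0_def block_def skip_def e_def split: if_splits)
      then show ?thesis
        by blast
    qed simp
  qed
  then have "card J \<le> card (insert e (skip ` I0))"
    using fin by (intro card_mono) auto
  also have "\<dots> \<le> Suc (card (skip ` I0))"
    using fin by (simp add: card_insert_if)
  also have "\<dots> \<le> Suc (card I0)"
    using fin by (simp add: card_image_le)
  finally have "n - d \<le> card I0"
    using J(2) by linarith
  then obtain I where I: "I \<subseteq> I0" "card I = n - d" "finite I"
    by (rule obtain_subset_with_card_n)
  have block: "block k \<subseteq> J" "k \<in> {1..n}" if "k \<in> I" for k
    using I that by (auto simp: I0_def)
  have "(\<Sum>k\<in>I. \<nu> (face n G i g k)) \<le> (\<Sum>k\<in>I. \<Sum>j\<in>block k. \<nu> (g j))"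
  proof (rule sum_mono)
    fix k assume "k \<in> I"
    then show "\<nu> (face n G i g k) \<le> (\<Sum>j\<in>block k. \<nu> (g j))"
      using block[of k] by (auto simp: face_def block_def intro!: norm_mult tuples_nth[OF g])
  qed
  also have "\<dots> = (\<Sum>j\<in>\<Union>(block ` I). \<nu> (g j))"
    using I(3) by (subst sum.UNION_disjoint) (auto simp: block_def)
  also have "\<dots> \<le> (\<Sum>j\<in>J. \<nu> (g j))"
    using fin block J(1) by (intro sum_mono2) (auto intro!: norm_nonneg tuples_nth[OF g])
  finally show ?thesis
    using I block by (intro that) auto
qed

text \<open>
  On each of the \<open>n + 2\<close> faces the bound of \<open>c\<close> holds with the sum over \<open>J\<close> in place of its own
  sum, so both constants are multiplied by \<open>n + 2\<close>.
\<close>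

lemma (in normed_group) coboundary_in_cochains_d:
  assumes "c \<in> cochains_d n d G \<nu>"
  shows "coboundary n G c \<in> cochains_d (n + 1) d G \<nu>"
proof -
  obtain C D where C: "0 \<le> C" "0 \<le> D" "\<And>g I. g \<in> tuples G n \<Longrightarrow> I \<subseteq> {1..n} \<Longrightarrow>
      card I = n - d \<Longrightarrow> \<bar>c g\<bar> \<le> C * (\<Sum>i\<in>I. \<nu> (g i)) + D"
    using cochains_dE[OF assms] by blast
  show ?thesis
  proof (rule cochains_dI[where C = "real (n + 2) * C" and D = "real (n + 2) * D"])
    fix g J assume g: "g \<in> tuples G (n + 1)" and J: "J \<subseteq> {1..n + 1}" "card J = n + 1 - d"
    have face: "\<bar>c (face n G i g)\<bar> \<le> C * (\<Sum>j\<in>J. \<nu> (g j)) + D" if i: "i \<le> n + 1" for i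
    proof -
      obtain I where I: "I \<subseteq> {1..n}" "card I = n - d"
          and le: "(\<Sum>k\<in>I. \<nu> (face n G i g k)) \<le> (\<Sum>j\<in>J. \<nu> (g j))"
        by (rule face_norm_sum_le[OF g i J])
      have "\<bar>c (face n G i g)\<bar> \<le> C * (\<Sum>k\<in>I. \<nu> (face n G i g k)) + D"
        using I g i by (intro C(3) face_in_tuples monoid_axioms)
      also have "\<dots> \<le> C * (\<Sum>j\<in>J. \<nu> (g j)) + D"
        using C(1) le by (simp add: mult_left_mono)
      finally show ?thesis .
    qed
    have "\<bar>coboundary n G c g\<bar> \<le> (\<Sum>i\<le>n + 1. \<bar>(-1) ^ i * c (face n G i g)\<bar>)"
      unfolding coboundary_eq_sum_faces[OF g] by (rule sum_abs)
    also have "\<dots> \<le> (\<Sum>i\<le>n + 1. C * (\<Sum>j\<in>J. \<nu> (g j)) + D)"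
      using face by (intro sum_mono) (simp add: abs_mult)
    also have "\<dots> = real (n + 2) * C * (\<Sum>j\<in>J. \<nu> (g j)) + real (n + 2) * D"
      by (simp add: algebra_simps)
    finally show "\<bar>coboundary n G c g\<bar> \<le> \<dots>" .
  qed (use C in \<open>auto simp: coboundary_def\<close>)
qed

lemma (in normed_group) coboundary_module_hom:
  "coboundary n G \<in> module_hom class_ring (cochain_space n d G \<nu>) (cochain_space (n + 1) d G \<nu>)"
proof -
  have "coboundary n G (\<lambda>g\<in>tuples G n. b g + c g) =
      (\<lambda>g\<in>tuples G (n + 1). coboundary n G b g + coboundary n G c g)" (is "?l = ?r") for b c
  proof
    fix g
    show "?l g = ?r g"
    proof (cases "g \<in> tuples G (n + 1)")
      case True
      have "?l g = coboundary n G b g + coboundary n G c g"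
        unfolding coboundary_eq_sum_faces[OF True] sum.distrib[symmetric]
        using face_in_tuples[OF monoid_axioms True] by (intro sum.cong) (auto simp: distrib_left)
      then show ?thesis
        using True by simp
    qed (simp add: coboundary_def)
  qed
  moreover have "coboundary n G (\<lambda>g\<in>tuples G n. a * c g) =
      (\<lambda>g\<in>tuples G (n + 1). a * coboundary n G c g)" (is "?l = ?r") for a c
  proof
    fix g
    show "?l g = ?r g"
    proof (cases "g \<in> tuples G (n + 1)")
      case True
      have "?l g = a * coboundary n G c g"
        unfolding coboundary_eq_sum_faces[OF True] sum_distrib_left
        using face_in_tuples[OF monoid_axioms True] by (intro sum.cong) auto
      then show ?thesis
        using True by simp
    qed (simp add: coboundary_def)
  qed
  ultimately show ?thesis
    using coboundary_in_cochains_d[of _ n d] by (simp add: module_hom_def)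
qed

section \<open>Pullbacks and cohomology\<close>

lemma compose_in_tuples:
  assumes "\<phi> \<in> carrier G \<rightarrow> carrier H" "g \<in> tuples G n"
  shows "compose {1..n} \<phi> g \<in> tuples H n"
  using assms tuples_nth[OF assms(2)] by (auto simp: tuples_def compose_def)

lemma pullback_eq_compose:
  "pullback n G \<phi> c = (\<lambda>g\<in>tuples G n. c (compose {1..n} \<phi> g))"
  by (simp add: pullback_def compose_def)

lemma face_compose:
  assumes "\<phi> \<in> hom G H" "g \<in> tuples G (n + 1)" "i \<le> n + 1"
  shows "face n H i (compose {1..n + 1} \<phi> g) = compose {1..n} \<phi> (face n G i g)"
  using assms tuples_nth[OF assms(2)] by (auto simp: face_def compose_def fun_eq_iff hom_mult)

text \<open>
  The coboundary is an alternating sum over faces, and a homomorphism commutes with each face.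
\<close>

lemma pullback_coboundary:
  assumes "monoid G" and \<phi>: "\<phi> \<in> hom G H"
  shows "pullback (n + 1) G \<phi> (coboundary n H c) = coboundary n G (pullback n G \<phi> c)"
    (is "?l = ?r")
proof
  fix g
  show "?l g = ?r g"
  proof (cases "g \<in> tuples G (n + 1)")
    case g: True
    have "\<phi> \<in> carrier G \<rightarrow> carrier H"
      using \<phi> by (simp add: hom_def)
    then have "?l g = (\<Sum>i\<le>n + 1. (-1) ^ i * c (face n H i (compose {1..n + 1} \<phi> g)))"
      using g by (simp only: pullback_eq_compose restrict_apply if_True
          coboundary_eq_sum_faces compose_in_tuples)
    also have "\<dots> = ?r g"
      unfolding coboundary_eq_sum_faces[OF g]
    proof (intro sum.cong refl arg_cong2[of _ _ _ _ "(*)"])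
      fix i assume "i \<in> {..n + 1}"
      then show "c (face n H i (compose {1..n + 1} \<phi> g)) = pullback n G \<phi> c (face n G i g)"
        using face_compose[OF \<phi> g] face_in_tuples[OF assms(1) g]
        by (simp add: pullback_eq_compose)
    qed
    finally show ?thesis .
  qed (simp add: pullback_def coboundary_def)
qed

text \<open>
  A Lipschitz bound turns a sum of \<open>n - d\<close> norms in the target into a multiple of the corresponding
  sum in the source plus a constant, so the growth condition is preserved with the same \<open>d\<close>.
\<close>

lemma pullback_in_cochains_d:
  assumes \<phi>: "\<phi> \<in> lipschitz_hom G \<nu> H \<mu>" and c: "c \<in> cochains_d n d H \<mu>"
  shows "pullback n G \<phi> c \<in> cochains_d n d G \<nu>"
proof -
  obtain C D where C: "0 \<le> C" "0 \<le> D" "\<And>g I. g \<in> tuples H n \<Longrightarrow> I \<subseteq> {1..n} \<Longrightarrow>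
      card I = n - d \<Longrightarrow> \<bar>c g\<bar> \<le> C * (\<Sum>i\<in>I. \<mu> (g i)) + D"
    using cochains_dE[OF c] by blast
  obtain L K where L: "0 \<le> L" "0 \<le> K" "\<And>g. g \<in> carrier G \<Longrightarrow> \<mu> (\<phi> g) \<le> L * \<nu> g + K"
    using \<phi> by (auto simp: lipschitz_hom_def)
  have "\<phi> \<in> carrier G \<rightarrow> carrier H"
    using \<phi> by (auto simp: lipschitz_hom_def hom_def)
  note in_H = compose_in_tuples[OF this]
  show ?thesis
  proof (rule cochains_dI[where C = "C * L" and D = "C * (real (n - d) * K) + D"])
    fix g I assume g: "g \<in> tuples G n" and I: "I \<subseteq> {1..n}" "card I = n - d"
    have "(\<Sum>i\<in>I. \<mu> (compose {1..n} \<phi> g i)) \<le> (\<Sum>i\<in>I. L * \<nu> (g i) + K)"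
      using I g by (intro sum_mono) (auto simp: compose_def intro!: L(3) tuples_nth[OF g])
    also have "\<dots> = L * (\<Sum>i\<in>I. \<nu> (g i)) + real (n - d) * K"
      using I by (simp add: sum.distrib sum_distrib_left)
    finally have "C * (\<Sum>i\<in>I. \<mu> (compose {1..n} \<phi> g i))
        \<le> C * (L * (\<Sum>i\<in>I. \<nu> (g i)) + real (n - d) * K)"
      using C(1) by (rule mult_left_mono)
    then show "\<bar>pullback n G \<phi> c g\<bar> \<le> C * L * (\<Sum>i\<in>I. \<nu> (g i)) + (C * (real (n - d) * K) + D)"
      using C(3)[OF in_H[OF g] I] g by (simp add: pullback_eq_compose algebra_simps)
  qed (use C L in \<open>auto simp: pullback_def\<close>)
qed

lemma pullback_module_hom:
  assumes "\<phi> \<in> lipschitz_hom G \<nu> H \<mu>"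
  shows "pullback n G \<phi> \<in> module_hom class_ring (cochain_space n d H \<mu>) (cochain_space n d G \<nu>)"
proof -
  have "\<phi> \<in> carrier G \<rightarrow> carrier H"
    using assms by (auto simp: lipschitz_hom_def hom_def)
  note in_H = compose_in_tuples[OF this]
  show ?thesis
    using pullback_in_cochains_d[OF assms] in_H
    by (auto simp: module_hom_def pullback_eq_compose fun_eq_iff)
qed

lemma cocycles_d_eq:
  "cocycles_d n d G \<nu> = {c \<in> cochains_d n d G \<nu>. coboundary n G c = (\<lambda>g\<in>tuples G (n + 1). 0)}"
  by (simp add: cocycles_d_def a_kernel_def')

context normed_group
begin

lemma coboundary_mod_hom:
  "mod_hom class_ring (cochain_space n d G \<nu>) (cochain_space (n + 1) d G \<nu>) (coboundary n G)"
  by (intro mod_hom.intro mod_hom_axioms.intro module_cochain_space coboundary_module_hom)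

lemma submodule_cocycles_d: "submodule class_ring (cocycles_d n d G \<nu>) (cochain_space n d G \<nu>)"
  using mod_hom.ker_is_submodule[OF coboundary_mod_hom, of n d]
  unfolding mod_hom.ker_def[OF coboundary_mod_hom] by (simp add: cocycles_d_eq)

lemma coboundaries_d_subset_cocycles_d: "coboundaries_d n d G \<nu> \<subseteq> cocycles_d n d G \<nu>"
proof (cases n)
  case 0
  then show ?thesis
    using submodule.zero_closed[OF submodule_cocycles_d[of 0 d]] by (simp add: coboundaries_d_def)
next
  case (Suc m)
  then show ?thesis
    using coboundary_in_cochains_d[of _ m d] coboundary_coboundary[OF monoid_axioms, of m]
    by (auto simp: coboundaries_d_def cocycles_d_eq)
qed

lemma submodule_coboundaries_d:
  "submodule class_ring (coboundaries_d n d G \<nu>) (cochain_space n d G \<nu>)"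
proof (cases n)
  case 0
  then show ?thesis
    using module_cochain_space[of 0 d G \<nu>] cochains_d_zero[of G 0 d \<nu>]
    by (auto simp: coboundaries_d_def submodule_def fun_eq_iff)
next
  case (Suc m)
  then show ?thesis
    using mod_hom.im_is_submodule[OF coboundary_mod_hom, of m d]
    unfolding mod_hom.im_def[OF coboundary_mod_hom] by (simp add: coboundaries_d_def)
qed

abbreviation cocycle_space where
  "cocycle_space n d \<equiv> (cochain_space n d G \<nu>)\<lparr>carrier := cocycles_d n d G \<nu>\<rparr>"

lemma submodule_coboundaries_d_cocycle_space:
  "submodule class_ring (coboundaries_d n d G \<nu>) (cocycle_space n d)"
  by (intro submodule_of_submodule submodule_coboundaries_d submodule_cocycles_d
      coboundaries_d_subset_cocycles_d)

lemma vectorspace_cohomology: "vectorspace class_ring (cohomology n d G \<nu>)"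
  unfolding cohomology_def
  by (intro vectorspace.intro module_quotient_module[OF submodule_coboundaries_d_cocycle_space]
      class_field)

end

locale lipschitz_pullback = G: normed_group G \<nu> + H: normed_group H \<mu>
  for G :: "'a monoid" and \<nu> and H :: "'b monoid" and \<mu> +
  fixes \<phi>
  assumes lipschitz: "\<phi> \<in> lipschitz_hom G \<nu> H \<mu>"
begin

lemma group_hom: "\<phi> \<in> hom G H"
  using lipschitz by (simp add: lipschitz_hom_def)

lemma pullback_mod_hom:
  "mod_hom class_ring (cochain_space n d H \<mu>) (cochain_space n d G \<nu>) (pullback n G \<phi>)"
  by (intro mod_hom.intro mod_hom_axioms.intro module_cochain_space pullback_module_hom lipschitz)

text \<open>
  Since pullback commutes with the coboundary and maps zero to zero, it preserves cocycles; for the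
  same reason it preserves coboundaries. In degree zero this last point is only that zero goes to
  zero.
\<close>

lemma pullback_in_cocycles_d:
  assumes "c \<in> cocycles_d n d H \<mu>"
  shows "pullback n G \<phi> c \<in> cocycles_d n d G \<nu>"
proof -
  have c: "c \<in> cochains_d n d H \<mu>" and dc: "coboundary n H c = (\<lambda>g\<in>tuples H (n + 1). 0)"
    using assms by (auto simp: cocycles_d_eq)
  have "coboundary n G (pullback n G \<phi> c) = pullback (n + 1) G \<phi> (\<lambda>g\<in>tuples H (n + 1). 0)"
    using pullback_coboundary[OF G.monoid_axioms group_hom, of n c] by (simp only: dc)
  also have "\<dots> = (\<lambda>g\<in>tuples G (n + 1). 0)"
    using mod_hom.f0_is_0[OF pullback_mod_hom, of "n + 1" d] by simp
  finally show ?thesis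
    using pullback_in_cochains_d[OF lipschitz c] by (simp add: cocycles_d_eq)
qed

lemma pullback_coboundaries_d:
  "pullback n G \<phi> ` coboundaries_d n d H \<mu> \<subseteq> coboundaries_d n d G \<nu>"
proof (cases n)
  case 0
  then show ?thesis
    using mod_hom.f0_is_0[OF pullback_mod_hom, of 0 d] by (simp add: coboundaries_d_def)
next
  case (Suc m)
  then show ?thesis
    using pullback_coboundary[OF G.monoid_axioms group_hom, of m] pullback_in_cochains_d[OF lipschitz]
    by (auto simp: coboundaries_d_def)
qed

lemma pullback_cocycle_module_hom:
  "pullback n G \<phi> \<in> module_hom class_ring (H.cocycle_space n d) (G.cocycle_space n d)"
  using pullback_module_hom[OF lipschitz, of n d] pullback_in_cocycles_d[of _ n d]
  by (auto simp: module_hom_def cocycles_d_eq)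

lemma cohomology_map_coset:
  assumes "c \<in> cocycles_d n d H \<mu>"
  shows "cohomology_map n d G \<nu> H \<mu> \<phi> (coboundaries_d n d H \<mu> +>\<^bsub>cochain_space n d H \<mu>\<^esub> c)
    = coboundaries_d n d G \<nu> +>\<^bsub>cochain_space n d G \<nu>\<^esub> pullback n G \<phi> c"
proof -
  have "coboundaries_d n d H \<mu> +>\<^bsub>cochain_space n d H \<mu>\<^esub> c \<in> carrier (cohomology n d H \<mu>)"
    using a_r_coset_in_quotient_module[of c "H.cocycle_space n d"] assms
    by (simp add: cohomology_def)
  then show ?thesis
    using induced_map_coset[OF H.submodule_coboundaries_d_cocycle_space
        G.submodule_coboundaries_d_cocycle_space pullback_cocycle_module_hom
        pullback_coboundaries_d, of c n d] assms
    by (simp add: cohomology_map_def)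
qed

lemma cohomology_map_module_hom:
  "cohomology_map n d G \<nu> H \<mu> \<phi>
    \<in> module_hom class_ring (cohomology n d H \<mu>) (cohomology n d G \<nu>)"
  using induced_module_hom[OF H.submodule_coboundaries_d_cocycle_space
      G.submodule_coboundaries_d_cocycle_space pullback_cocycle_module_hom
      pullback_coboundaries_d, of n d]
  by (simp add: cohomology_map_def cohomology_def)

end

lemma cohomology_map_extensional:
  "cohomology_map n d G \<nu> H \<mu> \<phi> \<in> extensional (carrier (cohomology n d H \<mu>))"
  by (simp add: cohomology_map_def)

lemma cohomologyE:
  assumes "X \<in> carrier (cohomology n d G \<nu>)"
  obtains c where "c \<in> cocycles_d n d G \<nu>"
    "X = coboundaries_d n d G \<nu> +>\<^bsub>cochain_space n d G \<nu>\<^esub> c"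
  using assms unfolding cohomology_def by (elim quotient_moduleE) simp


section \<open>Functoriality\<close>

lemma pullback_restrict_id:
  assumes "c \<in> extensional (tuples G n)"
  shows "pullback n G (\<lambda>x\<in>carrier G. x) c = c"
proof
  fix g
  show "pullback n G (\<lambda>x\<in>carrier G. x) c g = c g"
  proof (cases "g \<in> tuples G n")
    case True
    then have "compose {1..n} (\<lambda>x\<in>carrier G. x) g = g"
      using tuples_nth[OF True] by (auto simp: compose_def fun_eq_iff tuples_def)
    then show ?thesis
      using True by (simp add: pullback_eq_compose)
  qed (use assms in \<open>simp add: pullback_def extensional_def\<close>)
qed

lemma pullback_compose:
  assumes "\<phi> \<in> carrier G \<rightarrow> carrier H"
  shows "pullback n G (compose (carrier G) \<psi> \<phi>) c = pullback n G \<phi> (pullback n H \<psi> c)"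
proof
  fix g
  show "pullback n G (compose (carrier G) \<psi> \<phi>) c g = pullback n G \<phi> (pullback n H \<psi> c) g"
  proof (cases "g \<in> tuples G n")
    case True
    have "compose {1..n} (compose (carrier G) \<psi> \<phi>) g = compose {1..n} \<psi> (compose {1..n} \<phi> g)"
      using tuples_nth[OF True] by (auto simp: compose_def fun_eq_iff)
    then show ?thesis
      using True compose_in_tuples[OF assms True] by (simp add: pullback_eq_compose)
  qed (simp add: pullback_def)
qed

lemma lipschitz_homI:
  assumes "\<phi> \<in> hom G H" "0 \<le> C" "0 \<le> D" "\<And>g. g \<in> carrier G \<Longrightarrow> \<mu> (\<phi> g) \<le> C * \<nu> g + D"
  shows "\<phi> \<in> lipschitz_hom G \<nu> H \<mu>"
  unfolding lipschitz_hom_def using assms by blast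

lemma lipschitz_hom_funcset: "\<phi> \<in> lipschitz_hom G \<nu> H \<mu> \<Longrightarrow> \<phi> \<in> carrier G \<rightarrow> carrier H"
  by (simp add: lipschitz_hom_def hom_def)

lemma restrict_id_lipschitz:
  assumes "normed_group G \<nu>"
  shows "(\<lambda>g\<in>carrier G. g) \<in> lipschitz_hom G \<nu> G \<nu>"
proof -
  interpret normed_group G \<nu> by fact
  show ?thesis
    by (rule lipschitz_homI[where C = 1 and D = 0]) (auto simp: hom_def)
qed

lemma compose_lipschitz:
  assumes "normed_group G \<nu>" and \<phi>: "\<phi> \<in> lipschitz_hom G \<nu> H \<mu>" and \<psi>: "\<psi> \<in> lipschitz_hom H \<mu> K \<kappa>"
  shows "compose (carrier G) \<psi> \<phi> \<in> lipschitz_hom G \<nu> K \<kappa>"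
proof -
  interpret normed_group G \<nu> by fact
  obtain A B where A: "\<And>g. g \<in> carrier G \<Longrightarrow> \<mu> (\<phi> g) \<le> A * \<nu> g + B" "0 \<le> A" "0 \<le> B"
    using \<phi> by (auto simp: lipschitz_hom_def)
  obtain C D where C: "\<And>h. h \<in> carrier H \<Longrightarrow> \<kappa> (\<psi> h) \<le> C * \<mu> h + D" "0 \<le> C" "0 \<le> D"
    using \<psi> by (auto simp: lipschitz_hom_def)
  have hom: "\<phi> \<in> hom G H" "\<psi> \<in> hom H K"
    using \<phi> \<psi> by (auto simp: lipschitz_hom_def)
  have bound: "\<kappa> (compose (carrier G) \<psi> \<phi> g) \<le> C * A * \<nu> g + (C * B + D)" if g: "g \<in> carrier G" for g
  proof -
    have "\<kappa> (\<psi> (\<phi> g)) \<le> C * \<mu> (\<phi> g) + D"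
      using hom(1) g by (intro C) (auto simp: hom_def)
    also have "C * \<mu> (\<phi> g) \<le> C * (A * \<nu> g + B)"
      using A(1)[OF g] C(2) by (rule mult_left_mono)
    finally show ?thesis
      using g by (simp add: compose_def algebra_simps)
  qed
  have "compose (carrier G) \<psi> \<phi> \<in> hom G K"
    using hom by (auto simp: hom_def compose_def Pi_iff)
  then show ?thesis
    using bound A(2,3) C(2,3) by (intro lipschitz_homI[where C = "C * A" and D = "C * B + D"]) auto
qed

lemma category_NGrp: "category (NGrp :: ('a monoid \<times> ('a \<Rightarrow> real), 'a \<Rightarrow> 'a) category)"
proof
  fix X Y f assume f: "f \<in> Hom (NGrp :: ('a monoid \<times> ('a \<Rightarrow> real), 'a \<Rightarrow> 'a) category) X Y"
  show "Comp NGrp X X Y f (Ident NGrp X) = f" "Comp NGrp X Y Y (Ident NGrp Y) f = f"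
    using f by (auto simp: NGrp_def lipschitz_hom_def hom_def compose_def fun_eq_iff extensional_def
        split: prod.splits)
qed (auto simp: NGrp_def restrict_id_lipschitz
    intro: compose_lipschitz compose_assoc[OF lipschitz_hom_funcset, symmetric])

lemma compose_module_hom:
  assumes "f \<in> module_hom R U V" "g \<in> module_hom R V W" "module R U"
  shows "compose (carrier U) g f \<in> module_hom R U W"
proof -
  interpret U: module R U by fact
  show ?thesis
    using assms(1,2) by (auto simp: module_hom_def compose_def Pi_iff)
qed

lemma category_Vect_R: "category (Vect_R :: ((real, 'v) module, 'v \<Rightarrow> 'v) category)"
proof
  fix V :: "(real, 'v) module"
  assume "V \<in> Obj Vect_R"
  then interpret V: vectorspace class_ring V
    by (simp add: Vect_R_def)
  show "Ident Vect_R V \<in> Hom Vect_R V V"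
    by (auto simp: Vect_R_def module_hom_def)
next
  fix V W :: "(real, 'v) module" and f
  assume "f \<in> Hom Vect_R V W"
  then show "Comp Vect_R V V W f (Ident Vect_R V) = f" "Comp Vect_R V W W (Ident Vect_R W) f = f"
    by (auto simp: Vect_R_def module_hom_def compose_def fun_eq_iff extensional_def)
qed (auto simp: Vect_R_def vectorspace_def intro: compose_module_hom
    compose_assoc[OF module_hom_closed, symmetric])

text \<open>
  A class is represented by a cocycle and the induced map acts on representatives, so it is enough
  to compare pullbacks of cochains, where both functor laws are immediate.
\<close>

lemma cohomology_map_restrict_id:
  assumes "normed_group G \<nu>"
  shows "cohomology_map n d G \<nu> G \<nu> (\<lambda>g\<in>carrier G. g) = (\<lambda>X\<in>carrier (cohomology n d G \<nu>). X)"
proof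
  interpret normed_group G \<nu> by fact
  interpret lipschitz_pullback G \<nu> G \<nu> "\<lambda>g\<in>carrier G. g"
    by unfold_locales (rule restrict_id_lipschitz[OF assms])
  fix X
  show "cohomology_map n d G \<nu> G \<nu> (\<lambda>g\<in>carrier G. g) X = (\<lambda>X\<in>carrier (cohomology n d G \<nu>). X) X"
  proof (cases "X \<in> carrier (cohomology n d G \<nu>)")
    case True
    then obtain c where c: "c \<in> cocycles_d n d G \<nu>"
        and X: "X = coboundaries_d n d G \<nu> +>\<^bsub>cochain_space n d G \<nu>\<^esub> c"
      by (rule cohomologyE)
    have "pullback n G (\<lambda>g\<in>carrier G. g) c = c"
      using c by (intro pullback_restrict_id cochains_d_extensional[of c n d G \<nu>])
        (simp add: cocycles_d_eq)
    then have "cohomology_map n d G \<nu> G \<nu> (\<lambda>g\<in>carrier G. g) X = X"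
      using cohomology_map_coset[OF c] by (simp only: X)
    then show ?thesis
      using True by simp
  qed (simp add: cohomology_map_def)
qed

lemma cohomology_map_compose:
  assumes \<phi>: "lipschitz_pullback G \<nu> H \<mu> \<phi>" and \<psi>: "lipschitz_pullback H \<mu> K \<kappa> \<psi>"
  shows "cohomology_map n d G \<nu> K \<kappa> (compose (carrier G) \<psi> \<phi>)
    = compose (carrier (cohomology n d K \<kappa>))
        (cohomology_map n d G \<nu> H \<mu> \<phi>) (cohomology_map n d H \<mu> K \<kappa> \<psi>)"
proof
  interpret \<phi>: lipschitz_pullback G \<nu> H \<mu> \<phi> by fact
  interpret \<psi>: lipschitz_pullback H \<mu> K \<kappa> \<psi> by fact
  interpret \<psi>\<phi>: lipschitz_pullback G \<nu> K \<kappa> "compose (carrier G) \<psi> \<phi>"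
    by unfold_locales
      (rule compose_lipschitz[OF \<phi>.G.normed_group_axioms \<phi>.lipschitz \<psi>.lipschitz])
  fix X
  show "cohomology_map n d G \<nu> K \<kappa> (compose (carrier G) \<psi> \<phi>) X
    = compose (carrier (cohomology n d K \<kappa>))
        (cohomology_map n d G \<nu> H \<mu> \<phi>) (cohomology_map n d H \<mu> K \<kappa> \<psi>) X"
  proof (cases "X \<in> carrier (cohomology n d K \<kappa>)")
    case True
    then obtain c where c: "c \<in> cocycles_d n d K \<kappa>"
        and X: "X = coboundaries_d n d K \<kappa> +>\<^bsub>cochain_space n d K \<kappa>\<^esub> c"
      by (rule cohomologyE)
    have "cohomology_map n d G \<nu> K \<kappa> (compose (carrier G) \<psi> \<phi>) X
        = coboundaries_d n d G \<nu> +>\<^bsub>cochain_space n d G \<nu>\<^esub> pullback n G \<phi> (pullback n H \<psi> c)"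
      unfolding X \<psi>\<phi>.cohomology_map_coset[OF c]
        pullback_compose[OF lipschitz_hom_funcset[OF \<phi>.lipschitz]] ..
    also have "\<dots> = cohomology_map n d G \<nu> H \<mu> \<phi> (cohomology_map n d H \<mu> K \<kappa> \<psi> X)"
      unfolding X \<psi>.cohomology_map_coset[OF c]
        \<phi>.cohomology_map_coset[OF \<psi>.pullback_in_cocycles_d[OF c]] ..
    finally show ?thesis
      using True by (simp add: compose_def)
  qed (simp add: cohomology_map_def compose_def)
qed

theorem proposition3p9:
  fixes n d :: nat
  shows "contravariant_functor
    (NGrp :: ('a monoid \<times> ('a \<Rightarrow> real), 'a \<Rightarrow> 'a) category)
    Vect_R
    (\<lambda>(G, \<nu>). cohomology n d G \<nu>)
    (\<lambda>(G, \<nu>) (H, \<mu>) \<phi>. cohomology_map n d G \<nu> H \<mu> \<phi>)"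
proof -
  have pullback: "lipschitz_pullback G \<nu> H \<mu> \<phi>"
    if "normed_group G \<nu>" "normed_group H \<mu>" "\<phi> \<in> lipschitz_hom G \<nu> H \<mu>"
    for G H :: "'a monoid" and \<nu> \<mu> \<phi>
    using that by (intro lipschitz_pullback.intro lipschitz_pullback_axioms.intro)
  show ?thesis
  proof (intro contravariant_functor.intro contravariant_functor_axioms.intro category_NGrp
      category_Vect_R, goal_cases)
    case (1 X)
    then show ?case
      by (auto simp: NGrp_def Vect_R_def normed_group.vectorspace_cohomology)
  next
    case (2 X Y f)
    then show ?case
      by (auto simp: NGrp_def Vect_R_def cohomology_map_extensional
          intro!: lipschitz_pullback.cohomology_map_module_hom pullback)
  next
    case (3 X)
    then show ?case
      by (auto simp: NGrp_def Vect_R_def cohomology_map_restrict_id)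
  next
    case (4 X Y Z f g)
    then show ?case
      by (auto simp: NGrp_def Vect_R_def intro!: cohomology_map_compose pullback)
  qed
qed

end
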